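(* Let $G$ be a finite nilpotent group of class $3$ such that $3$ does not divide the order of $G$. Then $C({}^{\circ}G)=Z(G)=Z({}^{\circ}G)$.
   Context: For a group $G$, ${}^{\circ}G=(G,\circ)$ denotes the set $G$ with the binary operation $x\circ y=y^{-1}xy^{2}$, where the right-hand side is computed in $G$. When $G$ is nilpotent of class $3$, ${}^{\circ}G$ is known to be a gyrogroup and in particular a loop, with the same identity as $G$. For a loop $L$, the commutant is $C(L)=\{a\in L\mid xa=ax\ \forall x\in L\}$. The center $Z(L)$ is the set of all $a\in C(L)$ such that, for all $x,y\in L$, $(ax)y=a(xy)$, $(xa)y=x(ay)$ and $(xy)a=x(ya)$. $Z(G)$ is the usual center of the group $G$. All three are regarded as subsets of the common underlying set. *)

theory Defs
  imports "HOL-Algebra.Generated_Groups"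
begin

definition commutator_subgroup :: "('a, 'b) monoid_scheme \<Rightarrow> 'a set \<Rightarrow> 'a set \<Rightarrow> 'a set" where
  "commutator_subgroup G H K =
     generate G (\<Union>h\<in>H. \<Union>k\<in>K. {inv\<^bsub>G\<^esub> h \<otimes>\<^bsub>G\<^esub> inv\<^bsub>G\<^esub> k \<otimes>\<^bsub>G\<^esub> h \<otimes>\<^bsub>G\<^esub> k})"

text \<open>Indexed from 0: \<open>lower_central_series G n\<close> is the subgroup usually written
  \<open>\<gamma>\<^sub>n\<^sub>+\<^sub>1(G)\<close>.\<close>

primrec lower_central_series :: "('a, 'b) monoid_scheme \<Rightarrow> nat \<Rightarrow> 'a set" where
  "lower_central_series G 0 = carrier G"
| "lower_central_series G (Suc n) =
     commutator_subgroup G (lower_central_series G n) (carrier G)"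

text \<open>The class is exactly \<open>c\<close>, not merely at most \<open>c\<close>.\<close>

definition nilpotent_of_class :: "('a, 'b) monoid_scheme \<Rightarrow> nat \<Rightarrow> bool" where
  "nilpotent_of_class G c \<longleftrightarrow>
     group G \<and> lower_central_series G c = {\<one>\<^bsub>G\<^esub>} \<and>
     (\<forall>i<c. lower_central_series G i \<noteq> {\<one>\<^bsub>G\<^esub>})"

definition group_center :: "('a, 'b) monoid_scheme \<Rightarrow> 'a set" where
  "group_center G = {a \<in> carrier G. \<forall>x \<in> carrier G. a \<otimes>\<^bsub>G\<^esub> x = x \<otimes>\<^bsub>G\<^esub> a}"

text \<open>Loops are represented by the record \<open>monoid\<close>, used only for its carrier,
  operation and identity; no associativity is implied.\<close>

definition circ :: "('a, 'b) monoid_scheme \<Rightarrow> 'a monoid" where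
  "circ G = \<lparr> carrier = carrier G,
              mult = (\<lambda>x y. inv\<^bsub>G\<^esub> y \<otimes>\<^bsub>G\<^esub> x \<otimes>\<^bsub>G\<^esub> (y [^]\<^bsub>G\<^esub> (2::nat))),
              one = \<one>\<^bsub>G\<^esub> \<rparr>"

definition commutant :: "('a, 'b) monoid_scheme \<Rightarrow> 'a set" where
  "commutant L = {a \<in> carrier L. \<forall>x \<in> carrier L. x \<otimes>\<^bsub>L\<^esub> a = a \<otimes>\<^bsub>L\<^esub> x}"

definition loop_center :: "('a, 'b) monoid_scheme \<Rightarrow> 'a set" where
  "loop_center L = {a \<in> commutant L. \<forall>x \<in> carrier L. \<forall>y \<in> carrier L.
     (a \<otimes>\<^bsub>L\<^esub> x) \<otimes>\<^bsub>L\<^esub> y = a \<otimes>\<^bsub>L\<^esub> (x \<otimes>\<^bsub>L\<^esub> y) \<and>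
     (x \<otimes>\<^bsub>L\<^esub> a) \<otimes>\<^bsub>L\<^esub> y = x \<otimes>\<^bsub>L\<^esub> (a \<otimes>\<^bsub>L\<^esub> y) \<and>
     (x \<otimes>\<^bsub>L\<^esub> y) \<otimes>\<^bsub>L\<^esub> a = x \<otimes>\<^bsub>L\<^esub> (y \<otimes>\<^bsub>L\<^esub> a)}"

end

theory Submission
  imports Defs "HOL-Algebra.Multiplicative_Group" "HOL-Computational_Algebra.Primes"
begin

text \<open>
  Write \<open>[x, a] = x\<^sup>-\<^sup>1 a\<^sup>-\<^sup>1 x a\<close>, so that \<open>x \<circ> a = a\<^sup>-\<^sup>1 x a\<^sup>2 = x [x, a] a\<close>.
  Multiplying by a central element of \<open>G\<close> means the same in \<open>G\<close> and in \<open>(G, \<circ>)\<close>, so the center of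
  \<open>G\<close> lies in the center of the loop, which lies in the commutant by definition.  The content is
  that an element \<open>a\<close> of the commutant is central in \<open>G\<close>.

  Put \<open>c = [x, a]\<close>.  The equation \<open>x \<circ> a = a \<circ> x\<close> says exactly that \<open>c\<close>, its conjugate by \<open>a\<close>
  and its conjugate by \<open>x\<close> multiply to \<open>1\<close> (\<open>commuting_imp_conjugates_of_commutator\<close>).
  In class 3 the conjugates of \<open>c\<close> differ from \<open>c\<close> by elements of the third term of the lower
  central series, which are central; hence \<open>c\<^sup>3\<close> is central.  Since 3 is prime to the order
  of \<open>G\<close>, \<open>c\<close> is a power of \<open>c\<^sup>3\<close> (\<open>coprime_power_invertible\<close>), so \<open>c\<close> itself is central.
  But then its conjugates are all equal to \<open>c\<close>, the product above is \<open>c\<^sup>3\<close>, so \<open>c\<^sup>3 = 1\<close> and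
  \<open>c = 1\<close>.
\<close>

lemma (in group) inv_cancel_left:
  assumes "x \<in> carrier G" and "y \<in> carrier G"
  shows "inv x \<otimes> (x \<otimes> y) = y" and "x \<otimes> (inv x \<otimes> y) = y"
  using assms by (simp_all add: m_assoc[symmetric])

lemma (in group) commutator_eq_one_iff:
  assumes "x \<in> carrier G" and "y \<in> carrier G"
  shows "inv x \<otimes> inv y \<otimes> x \<otimes> y = \<one> \<longleftrightarrow> x \<otimes> y = y \<otimes> x"
proof -
  have "inv x \<otimes> inv y \<otimes> x \<otimes> y = inv (y \<otimes> x) \<otimes> (x \<otimes> y)"
    using assms by (simp add: inv_mult_group m_assoc)
  then show ?thesis
    using assms by (metis inv_closed inv_inv inv_equality l_inv m_closed)
qed

lemma (in group) group_centerD: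
  assumes "a \<in> group_center G" and "x \<in> carrier G"
  shows "a \<otimes> x = x \<otimes> a"
  using assms by (simp add: group_center_def)

lemma (in group) subgroup_group_center: "subgroup (group_center G) G"
proof (rule subgroupI)
  show "group_center G \<subseteq> carrier G" and "group_center G \<noteq> {}"
    by (auto simp: group_center_def intro: exI[of _ \<one>])
next
  fix a assume a: "a \<in> group_center G"
  then have ac: "a \<in> carrier G" by (simp add: group_center_def)
  have "inv a \<otimes> x = x \<otimes> inv a" if x: "x \<in> carrier G" for x
  proof -
    have "inv a \<otimes> x = inv a \<otimes> (x \<otimes> a \<otimes> inv a)"
      using ac x by (simp add: m_assoc)
    also have "\<dots> = inv a \<otimes> (a \<otimes> x \<otimes> inv a)"
      using group_centerD[OF a x] by simp
    also have "\<dots> = x \<otimes> inv a"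
      using ac x by (simp add: m_assoc inv_cancel_left)
    finally show ?thesis .
  qed
  then show "inv a \<in> group_center G" using ac by (simp add: group_center_def)
next
  fix a b assume a: "a \<in> group_center G" and b: "b \<in> group_center G"
  then have abc: "a \<in> carrier G" "b \<in> carrier G" by (simp_all add: group_center_def)
  have "a \<otimes> b \<otimes> x = x \<otimes> (a \<otimes> b)" if x: "x \<in> carrier G" for x
    using abc x group_centerD[OF a x] group_centerD[OF b x] by (metis m_assoc)
  then show "a \<otimes> b \<in> group_center G" using abc by (simp add: group_center_def)
qed

lemma circ_simps [simp]:
  "carrier (circ G) = carrier G"
  "x \<otimes>\<^bsub>circ G\<^esub> y = inv\<^bsub>G\<^esub> y \<otimes>\<^bsub>G\<^esub> x \<otimes>\<^bsub>G\<^esub> (y [^]\<^bsub>G\<^esub> (2::nat))"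
  by (simp_all add: circ_def)

lemma (in group) pow_two: "x \<in> carrier G \<Longrightarrow> x [^] (2::nat) = x \<otimes> x"
  by (simp add: numeral_2_eq_2)

lemma (in group) circ_closed:
  assumes "x \<in> carrier G" and "y \<in> carrier G"
  shows "x \<otimes>\<^bsub>circ G\<^esub> y \<in> carrier G"
  using assms by simp

text \<open>In \<open>x \<circ> (a y) = (a y)\<^sup>-\<^sup>1 x (a y)\<^sup>2\<close> a central \<open>a\<close> occurs with total exponent
  \<open>-1 + 2 = 1\<close>, which is why it comes out of the right factor as a single \<open>a\<close>.\<close>

lemma (in group) circ_central_factors:
  assumes a: "a \<in> group_center G" and x: "x \<in> carrier G" and y: "y \<in> carrier G"
  shows "x \<otimes>\<^bsub>circ G\<^esub> a = a \<otimes> x"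
    and "a \<otimes>\<^bsub>circ G\<^esub> x = a \<otimes> x"
    and "(a \<otimes> x) \<otimes>\<^bsub>circ G\<^esub> y = a \<otimes> (x \<otimes>\<^bsub>circ G\<^esub> y)"
    and "x \<otimes>\<^bsub>circ G\<^esub> (a \<otimes> y) = a \<otimes> (x \<otimes>\<^bsub>circ G\<^esub> y)"
proof -
  have ac: "a \<in> carrier G" using a by (simp add: group_center_def)
  have out: "u \<otimes> (a \<otimes> v) = a \<otimes> (u \<otimes> v)" if "u \<in> carrier G" "v \<in> carrier G" for u v
    using that ac group_centerD[OF a that(1)] by (metis m_assoc)
  have xa: "x \<otimes> a = a \<otimes> x" using group_centerD[OF a x] by simp
  have "x \<otimes>\<^bsub>circ G\<^esub> a = inv a \<otimes> (x \<otimes> a) \<otimes> a"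
    using ac x by (simp add: pow_two m_assoc)
  also have "\<dots> = x \<otimes> a"
    unfolding xa using ac x by (simp add: m_assoc inv_cancel_left xa)
  finally show "x \<otimes>\<^bsub>circ G\<^esub> a = a \<otimes> x" using xa by simp
  show "a \<otimes>\<^bsub>circ G\<^esub> x = a \<otimes> x"
    using ac x out[of "inv x" "x \<otimes> x"] by (simp add: pow_two m_assoc inv_cancel_left)
  show "(a \<otimes> x) \<otimes>\<^bsub>circ G\<^esub> y = a \<otimes> (x \<otimes>\<^bsub>circ G\<^esub> y)"
    using ac x y out[of "inv y" "x \<otimes> (y \<otimes> y)"] by (simp add: pow_two m_assoc)
  have "x \<otimes>\<^bsub>circ G\<^esub> (a \<otimes> y) = inv y \<otimes> (inv a \<otimes> (x \<otimes> (a \<otimes> (y \<otimes> (a \<otimes> y)))))"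
    using ac x y by (simp add: pow_two m_assoc inv_mult_group)
  also have "\<dots> = inv y \<otimes> (inv a \<otimes> (a \<otimes> (a \<otimes> (x \<otimes> (y \<otimes> y)))))"
    using ac x y by (simp add: out[of x] out[of y])
  also have "\<dots> = a \<otimes> (x \<otimes>\<^bsub>circ G\<^esub> y)"
    using ac x y by (simp add: inv_cancel_left out[of "inv y"] pow_two m_assoc)
  finally show "x \<otimes>\<^bsub>circ G\<^esub> (a \<otimes> y) = a \<otimes> (x \<otimes>\<^bsub>circ G\<^esub> y)" .
qed

lemma (in group) group_center_subset_loop_center_circ:
  "group_center G \<subseteq> loop_center (circ G)"
proof
  fix a assume a: "a \<in> group_center G"
  then have ac: "a \<in> carrier G" by (simp add: group_center_def)
  note central = circ_central_factors[OF a]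
  show "a \<in> loop_center (circ G)"
    unfolding loop_center_def commutant_def circ_simps(1)
    using ac central circ_closed by (simp del: circ_simps(2))
qed

text \<open>Both sides of \<open>x \<circ> a = a \<circ> x\<close> can be written as \<open>a x\<close> times conjugates of
  \<open>c = [x, a]\<close>: the left one is \<open>a x c \<cdot> a\<^sup>-\<^sup>1 c a\<close>, the right one \<open>a x \<cdot> x\<^sup>-\<^sup>1 c\<^sup>-\<^sup>1 x\<close>.\<close>

lemma (in group) commuting_imp_conjugates_of_commutator:
  assumes x: "x \<in> carrier G" and a: "a \<in> carrier G"
    and comm: "x \<otimes>\<^bsub>circ G\<^esub> a = a \<otimes>\<^bsub>circ G\<^esub> x"
    and c: "c = inv x \<otimes> inv a \<otimes> x \<otimes> a"
  shows "c \<otimes> (inv a \<otimes> c \<otimes> a) \<otimes> (inv x \<otimes> c \<otimes> x) = \<one>"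
proof -
  have eq: "inv a \<otimes> x \<otimes> a \<otimes> a = inv x \<otimes> a \<otimes> x \<otimes> x"
    using comm x a by (simp add: pow_two m_assoc)
  have "c \<otimes> (inv a \<otimes> c \<otimes> a) \<otimes> (inv x \<otimes> c \<otimes> x)
      = inv x \<otimes> inv a \<otimes> (inv a \<otimes> x \<otimes> a \<otimes> a) \<otimes> inv x \<otimes> inv x \<otimes> inv a \<otimes> x \<otimes> a \<otimes> x"
    unfolding c using x a by (simp add: m_assoc inv_cancel_left)
  also have "\<dots> = \<one>"
    unfolding eq using x a by (simp add: m_assoc inv_cancel_left)
  finally show ?thesis .
qed

text \<open>Bezout's identity inverts the exponent \<open>m\<close> modulo the group order, which annihilates
  every element.\<close>

lemma (in group) coprime_power_invertible:
  assumes "finite (carrier G)" and "coprime m (order G)" and "m \<noteq> 0"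
  shows "\<exists>k::nat. \<forall>c \<in> carrier G. (c [^] (m::nat)) [^] k = c"
proof -
  obtain k l where kl: "m * k = order G * l + gcd m (order G)"
    using bezout_nat[OF assms(3)] by blast
  have "(c [^] m) [^] k = c" if c: "c \<in> carrier G" for c
  proof -
    have "(c [^] m) [^] k = c [^] (order G * l + 1)"
      using c kl assms(2) by (simp add: nat_pow_pow)
    also have "\<dots> = (c [^] order G) [^] l \<otimes> c"
      using c by (simp add: nat_pow_pow)
    also have "\<dots> = c"
      using c pow_order_eq_1[OF c] by simp
    finally show ?thesis .
  qed
  then show ?thesis by blast
qed

lemma commutator_in_lower_central_series:
  assumes "h \<in> lower_central_series G n" and "k \<in> carrier G"
  shows "inv\<^bsub>G\<^esub> h \<otimes>\<^bsub>G\<^esub> inv\<^bsub>G\<^esub> k \<otimes>\<^bsub>G\<^esub> h \<otimes>\<^bsub>G\<^esub> k \<in> lower_central_series G (Suc n)"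
  unfolding lower_central_series.simps commutator_subgroup_def
  using assms by (blast intro: generate.incl)

lemma (in group) last_lower_central_series_central:
  assumes "lower_central_series G (Suc n) = {\<one>}"
    and "z \<in> lower_central_series G n" and "z \<in> carrier G"
  shows "z \<in> group_center G"
  using assms commutator_in_lower_central_series[OF assms(2)] commutator_eq_one_iff
  by (auto simp: group_center_def)

lemma (in group) commutant_circ_subset_group_center:
  assumes fin: "finite (carrier G)"
    and class3: "lower_central_series G 3 = {\<one>}"
    and ord: "\<not> 3 dvd order G"
  shows "commutant (circ G) \<subseteq> group_center G"
proof
  fix a assume "a \<in> commutant (circ G)"
  then have a: "a \<in> carrier G"
    and comm: "\<And>x. x \<in> carrier G \<Longrightarrow> x \<otimes>\<^bsub>circ G\<^esub> a = a \<otimes>\<^bsub>circ G\<^esub> x"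
    unfolding commutant_def circ_simps(1) by blast+
  interpret Z: subgroup "group_center G" G by (rule subgroup_group_center)
  have "prime (3::nat)" by simp
  then have "coprime 3 (order G)"
    using ord by (rule prime_imp_coprime)
  then obtain k :: nat where root: "\<And>c. c \<in> carrier G \<Longrightarrow> (c [^] (3::nat)) [^] k = c"
    using coprime_power_invertible[OF fin _ zero_neq_numeral[symmetric]] by blast
  have "x \<otimes> a = a \<otimes> x" if x: "x \<in> carrier G" for x
  proof -
    define c where "c = inv x \<otimes> inv a \<otimes> x \<otimes> a"
    have c: "c \<in> carrier G" using x a by (simp add: c_def)
    have cube: "c [^] (3::nat) = c \<otimes> c \<otimes> c" using c by (simp add: numeral_3_eq_3)
    have prod: "c \<otimes> (inv a \<otimes> c \<otimes> a) \<otimes> (inv x \<otimes> c \<otimes> x) = \<one>"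
      by (rule commuting_imp_conjugates_of_commutator[OF x a comm[OF x] c_def])
    \<comment> \<open>\<open>d g\<close> is the central error made in replacing the conjugate of \<open>c\<close> by \<open>g\<close> by \<open>c\<close> itself.\<close>
    define d where "d g = inv c \<otimes> inv g \<otimes> c \<otimes> g" for g
    have d: "d g \<in> group_center G" and conj: "inv g \<otimes> c \<otimes> g = c \<otimes> d g"
      if g: "g \<in> carrier G" for g
    proof -
      have "c \<in> lower_central_series G (Suc 0)"
        unfolding c_def using x a by (intro commutator_in_lower_central_series) simp_all
      then have "d g \<in> lower_central_series G (Suc (Suc 0))"
        unfolding d_def using g by (rule commutator_in_lower_central_series)
      then show "d g \<in> group_center G"
      proof (rule last_lower_central_series_central[rotated])
        show "d g \<in> carrier G" using c g by (simp add: d_def)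
        show "lower_central_series G (Suc (Suc (Suc 0))) = {\<one>}"
          using class3 by (simp only: numeral_3_eq_3)
      qed
      show "inv g \<otimes> c \<otimes> g = c \<otimes> d g"
        using c g by (simp add: d_def m_assoc inv_cancel_left)
    qed
    have dc: "d a \<in> carrier G" "d x \<in> carrier G"
      using d[OF a] d[OF x] Z.subset by auto
    have "c \<otimes> c \<otimes> c \<otimes> (d a \<otimes> d x) = c \<otimes> (c \<otimes> d a) \<otimes> (c \<otimes> d x)"
    proof -
      have "d a \<otimes> (c \<otimes> d x) = c \<otimes> (d a \<otimes> d x)"
        using c dc group_centerD[OF d[OF a] c] by (simp add: m_assoc[symmetric])
      then show ?thesis using c dc by (simp add: m_assoc)
    qed
    also have "\<dots> = \<one>" using prod conj[OF a] conj[OF x] by simp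
    finally have "inv (d a \<otimes> d x) = c \<otimes> c \<otimes> c"
      by (rule inv_equality) (simp_all add: c dc)
    then have "c [^] (3::nat) = inv (d a \<otimes> d x)"
      by (simp only: cube)
    then have "c [^] (3::nat) \<in> group_center G"
      using d[OF a] d[OF x] by simp
    \<comment> \<open>The first use of \<open>k\<close>: centrality passes from \<open>c\<^sup>3\<close> to \<open>c\<close>.\<close>
    then have "(c [^] (3::nat)) [^] k \<in> group_center G"
      by (induction k) simp_all
    then have central: "c \<in> group_center G" by (simp only: root[OF c])
    have "inv g \<otimes> c \<otimes> g = c" if "g \<in> carrier G" for g
      using that c group_centerD[OF central that] by (simp add: m_assoc inv_cancel_left)
    then have "c [^] (3::nat) = \<one>" using prod x a cube by simp
    then have "c = \<one>" using root[OF c] nat_pow_one[of k] by simp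
    then show ?thesis unfolding c_def commutator_eq_one_iff[OF x a] .
  qed
  then show "a \<in> group_center G" using a unfolding group_center_def by force
qed

theorem corollary2p4:
  fixes G :: "('a, 'b) monoid_scheme"
  assumes "group G"
    and "finite (carrier G)"
    and "nilpotent_of_class G 3"
    and "\<not> 3 dvd order G"
  shows "commutant (circ G) = group_center G \<and> group_center G = loop_center (circ G)"
proof -
  interpret group G by (rule assms(1))
  have "commutant (circ G) \<subseteq> group_center G"
    using assms by (intro commutant_circ_subset_group_center) (simp_all add: nilpotent_of_class_def)
  moreover have "loop_center (circ G) \<subseteq> commutant (circ G)"
    by (auto simp: loop_center_def)
  ultimately show ?thesis
    using group_center_subset_loop_center_circ by blast
qed

end
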